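(* For every $m \in \mathbb{N}$, the polynomials $\begin{bmatrix} m+1 \\ 1 \end{bmatrix}_{\mathcal{F}}$, $\begin{bmatrix} m+2 \\ 2 \end{bmatrix}_{\mathcal{F}}$, and $\begin{bmatrix} m+3 \\ 3 \end{bmatrix}_{\mathcal{F}}$ (in the variable $q$) are unimodal.
   Context: $F_n$ denotes the Fibonacci numbers: $F_0=0$, $F_1=1$, $F_n=F_{n-1}+F_{n-2}$ for $n\ge 2$. For a positive integer $n$, $[n]_q := 1+q+\dots+q^{n-1}$, and $[F_n]^!_q := \prod_{k=1}^n [F_k]_q$. For $m,n\in\mathbb{N}$ (positive integers), the $q$-Fibonomial coefficient is $$\begin{bmatrix} m+n \\ n \end{bmatrix}_{\mathcal{F}} := \frac{[F_{m+n}]^!_q}{[F_m]^!_q\,[F_n]^!_q},$$ which is known to be a polynomial in $q$ with non-negative integer coefficients. A polynomial $\sum_{k=0}^N c_k q^k$ is unimodal if there is an $M$ with $c_0\le c_1\le\dots\le c_{M-1}\le c_M\ge c_{M+1}\ge\dots\ge c_N$. *)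

theory Defs
  imports "HOL-Number_Theory.Fib" "HOL-Computational_Algebra.Polynomial"
begin

definition q_int :: "nat \<Rightarrow> int poly" where
  "q_int n = (\<Sum>k<n. monom 1 k)"

definition q_fib_fact :: "nat \<Rightarrow> int poly" where
  "q_fib_fact n = (\<Prod>k=1..n. q_int (fib k))"

text \<open>
  The arguments are the two lower indices: \<open>q_fibonomial m n\<close> is the coefficient
  with \<open>m + n\<close> above \<open>n\<close>. The operator \<open>div\<close> on integer polynomials gives the true
  quotient only when the division is exact; lemma \<open>q_fibonomial_mult\<close> below shows
  that it always is here.
\<close>

definition q_fibonomial :: "nat \<Rightarrow> nat \<Rightarrow> int poly" where
  "q_fibonomial m n = q_fib_fact (m + n) div (q_fib_fact m * q_fib_fact n)"

definition unimodal_poly :: "'a::{linorder, zero} poly \<Rightarrow> bool" where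
  "unimodal_poly p \<longleftrightarrow> (\<exists>M\<le>degree p.
     (\<forall>k<M. coeff p k \<le> coeff p (Suc k)) \<and>
     (\<forall>k\<in>{M..<degree p}. coeff p k \<ge> coeff p (Suc k)))"

lemma q_int_add: "q_int (a + b) = q_int a + monom 1 a * q_int b"
  by (induction b) (simp_all add: q_int_def distrib_left mult_monom add.assoc)

lemma q_int_dvd_mult: "q_int a dvd q_int (a * b)"
  by (induction b) (simp_all add: q_int_def[of 0] q_int_add)

lemma q_int_nonzero:
  assumes "n > 0"
  shows "q_int n \<noteq> 0"
proof -
  have "coeff (q_int n) 0 = 1"
    using assms by (simp add: q_int_def coeff_sum)
  then show ?thesis by auto
qed

lemma q_fib_fact_0 [simp]: "q_fib_fact 0 = 1"
  by (simp add: q_fib_fact_def)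

lemma q_fib_fact_Suc: "q_fib_fact (Suc n) = q_fib_fact n * q_int (fib (Suc n))"
  by (simp add: q_fib_fact_def)

lemma q_fib_fact_nonzero: "q_fib_fact n \<noteq> 0"
  by (induction n) (simp_all add: q_fib_fact_Suc q_int_nonzero fib_neq_0_nat del: fib.simps)

lemma q_fib_fact_mult_dvd: "q_fib_fact m * q_fib_fact n dvd q_fib_fact (m + n)"
proof (induction "m + n" arbitrary: m n rule: less_induct)
  case less
  show ?case
  proof (cases "m = 0 \<or> n = 0")
    case True
    then show ?thesis by auto
  next
    case False
    then obtain a b where ab: "m = Suc a" "n = Suc b"
      by (metis not0_implies_Suc)
    define s where "s = a + Suc b"
    define x where "x = fib m * fib (Suc n)"
    define y where "y = fib n * fib a"
    have fs: "fib (Suc s) = x + y"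
      using fib_add[of a "Suc b"] by (simp add: s_def x_def y_def ab mult.commute del: fib.simps)
    have fact: "q_fib_fact (m + n) =
        q_fib_fact s * q_int x + q_fib_fact s * q_int y * monom 1 x"
    proof -
      have "m + n = Suc s"
        by (simp add: ab s_def)
      then show ?thesis
        by (simp only: q_fib_fact_Suc fs q_int_add) (simp add: algebra_simps)
    qed
    have "q_fib_fact a * q_fib_fact n dvd q_fib_fact s"
      using less[of a n] by (simp add: ab s_def)
    then have "(q_fib_fact a * q_fib_fact n) * q_int (fib m) dvd q_fib_fact s * q_int x"
      unfolding x_def by (intro mult_dvd_mono q_int_dvd_mult)
    then have 1: "q_fib_fact m * q_fib_fact n dvd q_fib_fact s * q_int x"
      by (simp add: ab q_fib_fact_Suc mult_ac del: fib.simps)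
    have "q_fib_fact m * q_fib_fact b dvd q_fib_fact s"
      using less[of m b] by (simp add: ab s_def)
    then have "(q_fib_fact m * q_fib_fact b) * q_int (fib n) dvd q_fib_fact s * q_int y"
      unfolding y_def by (intro mult_dvd_mono q_int_dvd_mult)
    then have 2: "q_fib_fact m * q_fib_fact n dvd q_fib_fact s * q_int y"
      by (simp add: ab q_fib_fact_Suc mult_ac del: fib.simps)
    show ?thesis
      unfolding fact by (intro dvd_add 1 dvd_mult2[OF 2])
  qed
qed

lemma q_fibonomial_mult:
  "q_fibonomial m n * (q_fib_fact m * q_fib_fact n) = q_fib_fact (m + n)"
  unfolding q_fibonomial_def by (rule dvd_div_mult_self[OF q_fib_fact_mult_dvd])

end

theory Submission
  imports Defs
begin

text \<open>
  Since \<open>F\<^sub>1 = F\<^sub>2 = 1\<close> and \<open>F\<^sub>3 = 2\<close>, the three polynomials are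
  \<open>[a]\<close>, \<open>[a][b]\<close> and \<open>[a][b][a+b] / [2]\<close> with \<open>a = F\<^bsub>m+1\<^esub>\<close> and \<open>b = F\<^bsub>m+2\<^esub>\<close>.
  All of them are palindromic, because every \<open>[n]\<close> is. So it is enough that the
  coefficients do not decrease up to the middle, that is, that
  the coefficients of \<open>(1 - q) p(q)\<close> are non-negative up to half the degree of \<open>p\<close>
  (lemma \<open>palindromic_unimodal\<close>).

  For \<open>p = [a][b]\<close> with \<open>a \<le> b\<close> this is clear from \<open>(1 - q)[a][b] = [a](1 - q\<^sup>b)\<close>.
  For \<open>p = [a][b][a+b] / [2]\<close>,
  \<open>(1 - q) p = (1 - q\<^sup>a)(1 - q\<^sup>b)(1 - q\<^bsup>a+b\<^esup>) / ((1 - q)(1 - q\<^sup>2))\<close>,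
  where \<open>1 / ((1-q)(1-q\<^sup>2))\<close> is the generating function of
  \<open>P(j) = \<lfloor>j/2\<rfloor> + 1\<close>, the number of partitions of \<open>j\<close> into parts \<open>1\<close> and \<open>2\<close>.
  The degree of \<open>p\<close> is \<open>2(a + b) - 4\<close>, so only exponents \<open>j \<le> a + b - 2\<close> count.
  The term \<open>q\<^bsup>a+b\<^esup>\<close> does not reach these, and the coefficient is
  \<open>P(j) - P(j - a) - P(j - b)\<close>. If \<open>j\<close> is at least \<open>a\<close> and \<open>b\<close>, then
  \<open>\<lfloor>(j-a)/2\<rfloor> + \<lfloor>(j-b)/2\<rfloor> \<le> j - (a+b)/2 \<le> j/2 - 1\<close>, which makes it non-negative;
  otherwise at most one term is subtracted, and \<open>P\<close> is monotone.
  The argument works for all positive \<open>a\<close> and \<open>b\<close> for which the division by \<open>[2]\<close> is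
  exact; Fibonacci numbers enter only through \<open>F\<^bsub>m+3\<^esub> = F\<^bsub>m+1\<^esub> + F\<^bsub>m+2\<^esub>\<close> and this exactness.
\<close>

section \<open>Palindromic polynomials\<close>

text \<open>
  Symmetry turns the rise of the first half into the fall of the second half. If the
  degree is odd, the two middle coefficients agree, so the step between them needs no
  assumption.
\<close>

lemma palindromic_unimodal:
  fixes p :: "'a::linordered_idom poly"
  assumes sym: "reflect_poly p = p"
    and rise: "\<And>j. 2 * j \<le> degree p \<Longrightarrow> 0 \<le> coeff ((1 - monom 1 1) * p) j"
  shows "unimodal_poly p"
proof -
  let ?N = "degree p"
  have up: "coeff p k \<le> coeff p (Suc k)" if "2 * Suc k \<le> ?N" for k
    using rise[OF that] by (simp add: left_diff_distrib coeff_monom_mult)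
  have mirror: "coeff p (?N - k) = coeff p k" if "k \<le> ?N" for k
    using coeff_reflect_poly[of p k] sym that by simp
  have down: "coeff p (Suc k) \<le> coeff p k" if k: "?N div 2 \<le> k" "k < ?N" for k
  proof -
    define i where "i = ?N - Suc k"
    have i: "coeff p i = coeff p (Suc k)" "coeff p (Suc i) = coeff p k"
      using mirror[of "Suc k"] mirror[of k] k by (simp_all add: i_def Suc_diff_Suc)
    show ?thesis
    proof (cases "2 * Suc i \<le> ?N")
      case True
      then show ?thesis using up[of i] i by simp
    next
      case False
      then have "i = k" using k by (simp add: i_def)
      then show ?thesis using i by simp
    qed
  qed
  show ?thesis
    unfolding unimodal_poly_def
    by (rule exI[of _ "?N div 2"]) (auto intro!: up down)
qed

section \<open>The polynomials \<open>[n]\<close>\<close>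

lemma coeff_q_int: "coeff (q_int n) j = of_bool (j < n)"
  by (simp add: q_int_def coeff_sum)

lemma degree_q_int: "degree (q_int n) = n - 1"
proof (cases n)
  case 0
  then show ?thesis by (simp add: q_int_def)
next
  case (Suc k)
  show ?thesis
  proof (rule antisym)
    show "degree (q_int n) \<le> n - 1"
      by (rule degree_le) (auto simp: coeff_q_int)
    show "n - 1 \<le> degree (q_int n)"
      by (rule le_degree) (simp add: coeff_q_int Suc)
  qed
qed

lemma reflect_q_int: "reflect_poly (q_int n) = q_int n"
  by (rule poly_eqI) (auto simp: coeff_reflect_poly degree_q_int coeff_q_int)

lemma q_int_telescope: "(1 - monom 1 1) * q_int n = 1 - monom 1 n"
proof (induction n)
  case 0
  show ?case by (simp add: q_int_def)
next
  case (Suc n)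
  have "(1 - monom 1 1) * q_int (Suc n)
      = (1 - monom 1 1) * q_int n + (1 - monom 1 1) * monom 1 n"
    by (simp add: q_int_def distrib_left)
  also have "\<dots> = (1 - monom 1 n) + (1 - monom 1 1) * monom 1 n"
    by (simp only: Suc.IH)
  also have "\<dots> = 1 - monom 1 (Suc n)"
    by (simp add: left_diff_distrib mult_monom)
  finally show ?case .
qed

lemma q_int_1: "q_int (Suc 0) = 1"
  by (simp add: q_int_def)

section \<open>Unimodality of the products\<close>

lemma unimodal_q_int: "unimodal_poly (q_int n)"
proof (rule palindromic_unimodal[OF reflect_q_int])
  fix j assume "2 * j \<le> degree (q_int n)"
  then show "0 \<le> coeff ((1 - monom 1 1) * q_int n) j"
    unfolding q_int_telescope by (auto simp: degree_q_int)
qed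

lemma unimodal_q_int_mult:
  assumes "a > 0" "b > 0"
  shows "unimodal_poly (q_int a * q_int b)"
  using assms
proof (induction a b rule: linorder_wlog)
  case (le a b)
  show ?case
  proof (rule palindromic_unimodal)
    show "reflect_poly (q_int a * q_int b) = q_int a * q_int b"
      by (simp add: reflect_poly_mult reflect_q_int)
  next
    fix j assume "2 * j \<le> degree (q_int a * q_int b)"
    then have "j < b"
      using le by (simp add: degree_mult_eq q_int_nonzero degree_q_int)
    moreover have "(1 - monom 1 1) * (q_int a * q_int b) = q_int a - monom 1 b * q_int a"
    proof -
      have "(1 - monom 1 1) * (q_int a * q_int b) = q_int a * ((1 - monom 1 1) * q_int b)"
        by (rule mult.left_commute)
      then show ?thesis unfolding q_int_telescope by (simp add: algebra_simps)
    qed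
    ultimately show "0 \<le> coeff ((1 - monom 1 1) * (q_int a * q_int b)) j"
      by (simp add: coeff_monom_mult coeff_q_int)
  qed
next
  case (sym a b)
  then show ?case by (simp add: mult.commute)
qed

text \<open>
  Multiplying by \<open>1 - q\<^sup>2 = (1 - q)[2]\<close> clears the denominator, and turns the closed form
  of the coefficients of \<open>(1 - q) r\<close> into a recurrence with step \<open>2\<close>.
\<close>

lemma unimodal_q_int_triple_quotient:
  assumes pos: "a > 0" "b > 0"
    and r: "r * q_int 2 = q_int a * q_int b * q_int (a + b)"
  shows "unimodal_poly r"
proof (rule palindromic_unimodal)
  have q2: "q_int 2 \<noteq> 0" by (simp add: q_int_nonzero)
  have "reflect_poly r * q_int 2 = reflect_poly (r * q_int 2)"
    by (simp add: reflect_poly_mult reflect_q_int)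
  also have "\<dots> = r * q_int 2"
    by (simp add: r reflect_poly_mult reflect_q_int)
  finally show "reflect_poly r = r" using q2 by simp
next
  fix j assume "2 * j \<le> degree r"
  moreover have "degree r + 1 = (a - 1) + (b - 1) + (a + b - 1)"
  proof -
    have "r \<noteq> 0" using r pos by (auto simp: q_int_nonzero)
    then have "degree r + 1 = degree (r * q_int 2)"
      by (simp add: degree_mult_eq q_int_nonzero degree_q_int)
    then show ?thesis
      using pos by (simp add: r degree_mult_eq q_int_nonzero degree_q_int)
  qed
  ultimately have j: "j + 2 \<le> a + b" using pos by linarith
  define d where "d = (1 - monom 1 1) * r"
  have "(1 - monom 1 2) * d = (1 - monom 1 1) * (1 - monom 1 1) * (r * q_int 2)"
    by (simp add: d_def q_int_telescope[of 2, symmetric] mult_ac)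
  also have "\<dots> = (1 - monom 1 a) * (1 - monom 1 b) * q_int (a + b)"
    by (simp add: r q_int_telescope[of a, symmetric] q_int_telescope[of b, symmetric] mult_ac)
  also have "\<dots> = q_int (a + b) - monom 1 a * q_int (a + b) - monom 1 b * q_int (a + b)
                 + monom 1 (a + b) * q_int (a + b)"
    by (simp add: algebra_simps mult_monom)
  finally have "d = monom 1 2 * d + q_int (a + b) - monom 1 a * q_int (a + b)
                 - monom 1 b * q_int (a + b) + monom 1 (a + b) * q_int (a + b)"
    by (simp add: algebra_simps)
  then have recurrence: "coeff d i = (if i < 2 then 0 else coeff d (i - 2))
      + 1 - of_bool (a \<le> i) - of_bool (b \<le> i)" if "i < a + b" for i
    using that by (subst (asm) poly_eq_iff) (force simp: coeff_monom_mult coeff_q_int)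
  define P :: "int \<Rightarrow> int" where "P i = (if i < 0 then 0 else i div 2 + 1)" for i
  have P_step: "P i = P (i - 2) + of_bool (0 \<le> i)" for i
    by (auto simp: P_def)
  have closed: "coeff d i = P (int i) - P (int i - int a) - P (int i - int b)"
    if "i < a + b" for i
    using that
  proof (induction i rule: less_induct)
    case (less i)
    \<comment> \<open>\<open>P\<close> is zero at negative arguments, so the case \<open>i < 2\<close> needs no boundary term.\<close>
    have prev: "(if i < 2 then 0 else coeff d (i - 2))
        = P (int i - 2) - P (int i - 2 - int a) - P (int i - 2 - int b)"
      using less pos by (auto simp: P_def)
    show ?case
      using recurrence[OF less.prems] prev
        P_step[of "int i"] P_step[of "int i - int a"] P_step[of "int i - int b"]
      by (simp add: algebra_simps)
  qed
  have "0 \<le> P (int j) - P (int j - int a) - P (int j - int b)"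
  proof -
    have "2 * (x div 2) \<le> x \<and> x \<le> 2 * (x div 2) + 1" for x :: int by presburger
    from this[of "int j"] this[of "int j - int a"] this[of "int j - int b"] j
    show ?thesis unfolding P_def by (simp split: if_split)
  qed
  then show "0 \<le> coeff ((1 - monom 1 1) * r) j"
    using closed[of j] j by (simp add: d_def)
qed

section \<open>Fibonomial coefficients with small lower index\<close>

lemma q_fibonomial_1: "q_fibonomial m 1 = q_int (fib (m + 1))"
proof -
  have "q_fibonomial m 1 * q_fib_fact m = q_int (fib (m + 1)) * q_fib_fact m"
    using q_fibonomial_mult[of m 1] by (simp add: q_fib_fact_Suc q_int_1 mult_ac del: fib.simps(3))
  then show ?thesis by (simp add: q_fib_fact_nonzero)
qed

lemma q_fibonomial_2: "q_fibonomial m 2 = q_int (fib (m + 1)) * q_int (fib (m + 2))"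
proof -
  have "q_fib_fact 2 = 1"
    by (simp add: numeral_2_eq_2 q_fib_fact_Suc q_int_1)
  moreover have "q_fib_fact (m + 2) = q_int (fib (m + 1)) * q_int (fib (m + 2)) * q_fib_fact m"
    by (simp add: q_fib_fact_Suc mult_ac del: fib.simps(3))
  ultimately have "q_fibonomial m 2 * q_fib_fact m
      = q_int (fib (m + 1)) * q_int (fib (m + 2)) * q_fib_fact m"
    using q_fibonomial_mult[of m 2] by simp
  then show ?thesis using q_fib_fact_nonzero[of m] by (metis mult_right_cancel)
qed

lemma q_fibonomial_3:
  "q_fibonomial m 3 * q_int 2
     = q_int (fib (m + 1)) * q_int (fib (m + 2)) * q_int (fib (m + 1) + fib (m + 2))"
    (is "_ = ?rhs")
proof -
  have "q_fib_fact 3 = q_int 2"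
    by (simp add: numeral_3_eq_3 q_fib_fact_Suc q_int_1 numeral_2_eq_2)
  moreover have "fib (m + 3) = fib (m + 1) + fib (m + 2)"
    by (simp add: numeral_3_eq_3)
  then have "q_fib_fact (m + 3) = ?rhs * q_fib_fact m"
    by (simp add: numeral_3_eq_3 q_fib_fact_Suc mult_ac del: fib.simps(3))
  ultimately have "(q_fibonomial m 3 * q_int 2) * q_fib_fact m = ?rhs * q_fib_fact m"
    using q_fibonomial_mult[of m 3] by (simp add: mult_ac)
  then show ?thesis using q_fib_fact_nonzero[of m] by (metis mult_right_cancel)
qed

theorem theorem1p2:
  fixes m :: nat
  assumes "m \<ge> 1"
  shows "unimodal_poly (q_fibonomial m 1) \<and>
         unimodal_poly (q_fibonomial m 2) \<and>
         unimodal_poly (q_fibonomial m 3)"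
proof (intro conjI)
  have pos: "fib (m + 1) > 0" "fib (m + 2) > 0"
    by (simp_all add: fib_neq_0_nat del: fib.simps(3))
  show "unimodal_poly (q_fibonomial m 1)"
    unfolding q_fibonomial_1 by (rule unimodal_q_int)
  show "unimodal_poly (q_fibonomial m 2)"
    unfolding q_fibonomial_2 by (rule unimodal_q_int_mult[OF pos])
  show "unimodal_poly (q_fibonomial m 3)"
    by (rule unimodal_q_int_triple_quotient[OF pos q_fibonomial_3])
qed

end
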